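(* Let $\Omega\subset\mathbb{R}^n$ be compact and convex, $f\in C^1(\Omega)$ with $L$-Lipschitz gradient on $\Omega$ ($L>0$), and let $\mathcal{A}$ be a method satisfying the angle condition $\mathrm{SB}_{\mathcal A}(\Omega)=\tau>0$ and such that the SSC procedure always terminates in a finite number of steps. Let $\{x_k\}$ be generated by the first-order method with SSC. Let $\mu>0$ and assume that the KL condition with constant $\mu$ holds at every point of the limit set of $\{x_k\}$. Let $q=\left(1+\frac{\mu}{L}\frac{\tau^2}{(1+\tau)^2}\right)^{-1}$. Then $\{x_k\}$ converges to some $x^*\in\Omega$, and for some positive constants $M,\bar M$ and all $k$ $$f(x_k)-f(x^* )\le Mq^k,\qquad \|x_k-x^*\|\le\bar M q^{k/2}.$$
   Context: $\|\cdot\|$ is the Euclidean norm, $\hat c=c/\|c\|$ for $c\ne0$ and $\hat0=0$, $\bar B_R(x)$ the closed ball. $f\in C^1(\Omega)$ means continuously differentiable on an open set containing $\Omega$; $\|\nabla f(x)-\nabla f(y)\|\le L\|x-y\|$ for $x,y\in\Omega$. $T_\Omega(x)=\mathrm{cl}\{w:\exists\lambda>0,\ x+\lambda w\in\Omega\}$, $\pi(C,\cdot)$ is the Euclidean projection on a closed convex set $C$, $\pi_x(g)=\|\pi(T_\Omega(x),g)\|$; $x$ is stationary if $\pi_x(-\nabla f(x))=0$. KL condition with constant $\mu$ at a stationary point $x^*$: there exist $\eta,\delta>0$ such that $\pi_x(-\nabla f(x))\ge\sqrt{2\mu}\,(f(x)-f(x^* ))^{1/2}$ for every $x\in\Omega$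 with $\|x-x^*\|<\delta$ and $f(x^* )<f(x)<f(x^* )+\eta$. A method $\mathcal{A}$ assigns to every $(x,g)\in\Omega\times\mathbb{R}^n$ a set $\mathcal{A}(x,g)\subset (T_\Omega(x)\cap\{d:\langle g,d\rangle>0\})\cup\{0\}$ of feasible directions at $x$, with $\mathcal{A}(x,g)=\{0\}$ if $\pi_x(g)=0$ and $0\notin\mathcal{A}(x,g)\ne\emptyset$ otherwise. $\mathrm{DSB}_{\mathcal A}(\Omega,x,g)=\inf_{d\in\mathcal{A}(x,g)}\frac{\langle g,d\rangle}{\pi_x(g)\|d\|}$ if $\pi_x(g)\neq0$, and $=1$ otherwise; $\mathrm{SB}_{\mathcal A}(\Omega)=\inf_{x\in\Omega,g\in\mathbb{R}^n}\mathrm{DSB}_{\mathcal A}(\Omega,x,g)$. First-order method with SSC: from $x_0\in\Omega$, while $x_k$ is not stationary set $x_{k+1}=\mathrm{SSC}(x_k,-\nabla f(x_k))$. If some $x_m$ is stationary, the convention is $x_k=x_m$ for all $k\ge m$. Procedure $\mathrm{SSC}(\bar x,g)$ (with $g=-\nabla f(\bar x)$): set $y_0=\bar x$, $j=0$. (1) Select $d_j\in\mathcal A(y_j,g)$ and a maximal stepsize $\alpha^{(j)}_{\max}>0$ with $y_j+\alpha d_j\in\Omega$ for $\alpha\in[0,\alpha_{\max}^{(j)}]$. If $d_j=0$, return $y_j$. (2) Let $\Omega_j=\bar B_{\|g\|/(2L)}\!\left(\bar x+\frac{g}{2L}\right)\cap\bar B_{\langle g,\hat d_j\rangle/L}(\bar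 x)$, and let $\beta_j=0$ if $y_j\notin\Omega_j$, $\beta_j=\max\{\beta\ge0:y_j+\beta d_j\in\Omega_j\}$ if $y_j\in\Omega_j$. Set $\alpha_j=\min(\alpha^{(j)}_{\max},\beta_j)$, $y_{j+1}=y_j+\alpha_jd_j$. If $\alpha_j=\beta_j$, return $y_{j+1}$; otherwise set $j=j+1$ and go to (1). *)

theory Defs
  imports "HOL-Analysis.Analysis"
begin

text \<open>The gradient is carried as an explicit function \<open>gradf\<close>; differentiability and continuity are
  required on an open neighbourhood of \<open>\<Omega>\<close>, so \<open>gradf\<close> is determined by \<open>f\<close> on \<open>\<Omega>\<close>.\<close>

definition C1_near :: "'a::euclidean_space set \<Rightarrow> ('a \<Rightarrow> real) \<Rightarrow> ('a \<Rightarrow> 'a) \<Rightarrow> bool" where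
  "C1_near \<Omega> f gradf \<longleftrightarrow>
     (\<exists>U. open U \<and> \<Omega> \<subseteq> U \<and> (\<forall>x\<in>U. GDERIV f x :> gradf x) \<and> continuous_on U gradf)"

definition tangent_cone :: "'a::euclidean_space set \<Rightarrow> 'a \<Rightarrow> 'a set" where
  "tangent_cone \<Omega> x = closure {w. \<exists>t>0. x + t *\<^sub>R w \<in> \<Omega>}"

definition proj_norm :: "'a::euclidean_space set \<Rightarrow> 'a \<Rightarrow> 'a \<Rightarrow> real" where
  "proj_norm \<Omega> x g = norm (closest_point (tangent_cone \<Omega> x) g)"

definition stationary :: "'a::euclidean_space set \<Rightarrow> ('a \<Rightarrow> 'a) \<Rightarrow> 'a \<Rightarrow> bool" where
  "stationary \<Omega> gradf x \<longleftrightarrow> proj_norm \<Omega> x (- gradf x) = 0"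

text \<open>The inequality makes sense at every point; stationarity of the reference point is not made part
  of the condition.\<close>

definition KL_condition ::
    "'a::euclidean_space set \<Rightarrow> ('a \<Rightarrow> real) \<Rightarrow> ('a \<Rightarrow> 'a) \<Rightarrow> real \<Rightarrow> 'a \<Rightarrow> bool" where
  "KL_condition \<Omega> f gradf \<mu> xs \<longleftrightarrow>
     (\<exists>\<eta>>0. \<exists>\<delta>>0. \<forall>x\<in>\<Omega>. norm (x - xs) < \<delta> \<longrightarrow> f xs < f x \<longrightarrow> f x < f xs + \<eta> \<longrightarrow>
        proj_norm \<Omega> x (- gradf x) \<ge> sqrt (2 * \<mu>) * sqrt (f x - f xs))"

definition feasible_direction :: "'a::euclidean_space set \<Rightarrow> 'a \<Rightarrow> 'a \<Rightarrow> bool" where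
  "feasible_direction \<Omega> x d \<longleftrightarrow> (\<exists>\<epsilon>>0. \<forall>\<alpha>\<in>{0..\<epsilon>}. x + \<alpha> *\<^sub>R d \<in> \<Omega>)"

definition direction_method ::
    "'a::euclidean_space set \<Rightarrow> ('a \<Rightarrow> 'a \<Rightarrow> 'a set) \<Rightarrow> bool" where
  "direction_method \<Omega> A \<longleftrightarrow>
     (\<forall>x\<in>\<Omega>. \<forall>g.
        A x g \<subseteq> (tangent_cone \<Omega> x \<inter> {d. inner g d > 0}) \<union> {0} \<and>
        (\<forall>d\<in>A x g. feasible_direction \<Omega> x d) \<and>
        (if proj_norm \<Omega> x g = 0 then A x g = {0} else 0 \<notin> A x g \<and> A x g \<noteq> {}))"

text \<open>Both infima are taken in the reals; for a direction method and nonempty \<open>\<Omega>\<close> they range over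
  nonempty sets of nonnegative numbers.\<close>

definition DSB :: "'a::euclidean_space set \<Rightarrow> ('a \<Rightarrow> 'a \<Rightarrow> 'a set) \<Rightarrow> 'a \<Rightarrow> 'a \<Rightarrow> real" where
  "DSB \<Omega> A x g =
     (if proj_norm \<Omega> x g \<noteq> 0
      then INF d\<in>A x g. inner g d / (proj_norm \<Omega> x g * norm d) else 1)"

definition SB :: "'a::euclidean_space set \<Rightarrow> ('a \<Rightarrow> 'a \<Rightarrow> 'a set) \<Rightarrow> real" where
  "SB \<Omega> A = (INF (x, g)\<in>\<Omega> \<times> UNIV. DSB \<Omega> A x g)"

text \<open>\<open>S y g d\<close> is the set of values from which the maximal stepsize at \<open>y\<close> along \<open>d \<in> A y g\<close> may be
  selected. Taking the singleton of the largest feasible stepsize is one instance; smaller caps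
  are allowed as well.\<close>

definition stepsize_rule ::
    "'a::euclidean_space set \<Rightarrow> ('a \<Rightarrow> 'a \<Rightarrow> 'a set) \<Rightarrow> ('a \<Rightarrow> 'a \<Rightarrow> 'a \<Rightarrow> real set) \<Rightarrow> bool" where
  "stepsize_rule \<Omega> A S \<longleftrightarrow>
     (\<forall>y\<in>\<Omega>. \<forall>g. \<forall>d\<in>A y g. d \<noteq> 0 \<longrightarrow>
        S y g d \<noteq> {} \<and>
        (\<forall>amax\<in>S y g d. amax > 0 \<and> (\<forall>\<alpha>\<in>{0..amax}. y + \<alpha> *\<^sub>R d \<in> \<Omega>)))"

text \<open>Here \<open>sgn d\<close> is the normalization \<open>d /\<^sub>R norm d\<close>, with \<open>sgn 0 = 0\<close>.\<close>

definition SSC_region :: "real \<Rightarrow> 'a::euclidean_space \<Rightarrow> 'a \<Rightarrow> 'a \<Rightarrow> 'a set" where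
  "SSC_region L xbar g d =
     cball (xbar + (1 / (2 * L)) *\<^sub>R g) (norm g / (2 * L)) \<inter> cball xbar (inner g (sgn d) / L)"

definition SSC_beta :: "real \<Rightarrow> 'a::euclidean_space \<Rightarrow> 'a \<Rightarrow> 'a \<Rightarrow> 'a \<Rightarrow> real" where
  "SSC_beta L xbar g y d =
     (if y \<in> SSC_region L xbar g d
      then GREATEST \<beta>. \<beta> \<ge> 0 \<and> y + \<beta> *\<^sub>R d \<in> SSC_region L xbar g d else 0)"

text \<open>\<open>SSC_next A S L xbar g y y'\<close>: an iteration of the procedure started at \<open>(xbar, g)\<close> may lead from
  \<open>y\<^sub>j = y\<close> to \<open>y\<^sub>j\<^sub>+\<^sub>1 = y'\<close> without returning.\<close>

definition SSC_next ::
    "('a::euclidean_space \<Rightarrow> 'a \<Rightarrow> 'a set) \<Rightarrow> ('a \<Rightarrow> 'a \<Rightarrow> 'a \<Rightarrow> real set) \<Rightarrow> real \<Rightarrow> 'a \<Rightarrow> 'a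
      \<Rightarrow> 'a \<Rightarrow> 'a \<Rightarrow> bool" where
  "SSC_next A S L xbar g y y' \<longleftrightarrow>
     (\<exists>d amax \<alpha>. d \<in> A y g \<and> d \<noteq> 0 \<and> amax \<in> S y g d \<and>
        \<alpha> = min amax (SSC_beta L xbar g y d) \<and> \<alpha> \<noteq> SSC_beta L xbar g y d \<and>
        y' = y + \<alpha> *\<^sub>R d)"

text \<open>\<open>SSC_return A S L xbar g y z\<close>: an iteration starting at \<open>y\<^sub>j = y\<close> may return \<open>z\<close>.\<close>

definition SSC_return ::
    "('a::euclidean_space \<Rightarrow> 'a \<Rightarrow> 'a set) \<Rightarrow> ('a \<Rightarrow> 'a \<Rightarrow> 'a \<Rightarrow> real set) \<Rightarrow> real \<Rightarrow> 'a \<Rightarrow> 'a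
      \<Rightarrow> 'a \<Rightarrow> 'a \<Rightarrow> bool" where
  "SSC_return A S L xbar g y z \<longleftrightarrow>
     (0 \<in> A y g \<and> z = y) \<or>
     (\<exists>d amax \<alpha>. d \<in> A y g \<and> d \<noteq> 0 \<and> amax \<in> S y g d \<and>
        \<alpha> = min amax (SSC_beta L xbar g y d) \<and> \<alpha> = SSC_beta L xbar g y d \<and>
        z = y + \<alpha> *\<^sub>R d)"

definition SSC ::
    "('a::euclidean_space \<Rightarrow> 'a \<Rightarrow> 'a set) \<Rightarrow> ('a \<Rightarrow> 'a \<Rightarrow> 'a \<Rightarrow> real set) \<Rightarrow> real \<Rightarrow> 'a \<Rightarrow> 'a
      \<Rightarrow> 'a \<Rightarrow> bool" where
  "SSC A S L xbar g z \<longleftrightarrow>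
     (\<exists>y. (SSC_next A S L xbar g)\<^sup>*\<^sup>* xbar y \<and> SSC_return A S L xbar g y z)"

definition SSC_terminates ::
    "'a::euclidean_space set \<Rightarrow> ('a \<Rightarrow> 'a) \<Rightarrow> ('a \<Rightarrow> 'a \<Rightarrow> 'a set)
      \<Rightarrow> ('a \<Rightarrow> 'a \<Rightarrow> 'a \<Rightarrow> real set) \<Rightarrow> real \<Rightarrow> bool" where
  "SSC_terminates \<Omega> gradf A S L \<longleftrightarrow>
     (\<forall>xbar\<in>\<Omega>. \<not> (\<exists>y::nat \<Rightarrow> 'a. y 0 = xbar \<and>
        (\<forall>j. SSC_next A S L xbar (- gradf xbar) (y j) (y (Suc j)))))"

definition first_order_SSC ::
    "'a::euclidean_space set \<Rightarrow> ('a \<Rightarrow> 'a) \<Rightarrow> ('a \<Rightarrow> 'a \<Rightarrow> 'a set)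
      \<Rightarrow> ('a \<Rightarrow> 'a \<Rightarrow> 'a \<Rightarrow> real set) \<Rightarrow> real \<Rightarrow> (nat \<Rightarrow> 'a) \<Rightarrow> bool" where
  "first_order_SSC \<Omega> gradf A S L x \<longleftrightarrow>
     x 0 \<in> \<Omega> \<and>
     (\<forall>k. if stationary \<Omega> gradf (x k) then x (Suc k) = x k
          else SSC A S L (x k) (- gradf (x k)) (x (Suc k)))"

definition limit_set :: "(nat \<Rightarrow> 'a::topological_space) \<Rightarrow> 'a set" where
  "limit_set x = {p. \<exists>r. strict_mono r \<and> (x \<circ> r) \<longlonglongrightarrow> p}"

end

theory Submission
  imports Defs
begin

text \<open>
  Write \<open>g = - gradf xbar\<close> and let \<open>z\<close> be returned by the procedure started at \<open>xbar\<close>.  The first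
  ball of the region consists of the points with \<open>L * (norm (y - xbar))\<^sup>2 \<le> inner g (y - xbar)\<close>, so
  the descent lemma yields \<open>f z \<le> f xbar - L / 2 * (norm (z - xbar))\<^sup>2\<close>.  The second ball makes \<open>f\<close>
  nonincreasing along every segment of the inner path, because the gradient has turned by at
  most \<open>inner g (sgn d)\<close> as long as the path stays in it.

  The heart of the matter is that a long list of truncated inner steps cannot produce a bad outer
  step: some inner iterate \<open>xt\<close> with \<open>f z \<le> f xt \<le> f xbar\<close> satisfies
  \<open>\<tau> * proj_norm \<Omega> xt (- gradf xt) \<le> L * (1 + \<tau>) * norm (z - xbar)\<close> (lemma \<open>SSC_decrease\<close>).
  If the path stops at a zero direction or because of the second ball, the last inner iterate or \<open>z\<close>
  itself serves.  If it stops on the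
  boundary of the first ball, then \<open>L * (norm (z - xbar))\<^sup>2 = inner g (z - xbar)\<close>; since
  \<open>z - xbar\<close> is a nonnegative combination of the inner directions, this bounds
  \<open>L * norm (z - xbar)\<close> from below by the smallest of the slopes \<open>inner g (sgn d)\<close>, and the inner
  iterate at which the smallest slope occurs serves.

  Let \<open>p\<close> be a limit point.  Inserting \<open>xt\<close> into the KL inequality at \<open>p\<close> gives
  \<open>f (x (k + 1)) - f p \<le> q * (f (x k) - f p)\<close> whenever \<open>x k\<close> is close to \<open>p\<close> and \<open>k\<close> is large.  Since
  step lengths are controlled by the square root of the decrease, a potential of the form
  \<open>dist (x k) p + C * sqrt (f (x k) - f p)\<close> traps the sequence near \<open>p\<close> once it is small
  (lemma \<open>local_contraction_imp_linear_rate\<close>), and both rates follow.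
\<close>

section \<open>Sequences with a contraction near a limit point\<close>

text \<open>With \<open>s = sqrt q\<close> the contraction gives \<open>sqrt (E k) \<le> (sqrt (E k) - sqrt (E (k + 1))) / (1 - s)\<close>,
  so a step is bounded by a multiple of the drop of \<open>sqrt E\<close>.  Hence
  \<open>dist (x k) p + C * sqrt (E k)\<close> does not increase, which keeps the sequence in the ball, and
  \<open>dist (x k) p - C * sqrt (E k)\<close> does not decrease, which bounds the distance by the energy.\<close>

lemma local_contraction_imp_linear_rate:
  fixes x :: "nat \<Rightarrow> 'a::metric_space" and E :: "nat \<Rightarrow> real"
  assumes E0: "\<And>k. 0 \<le> E k" and Elim: "E \<longlonglongrightarrow> 0" and Edec: "decseq E"
    and step: "\<And>k. (dist (x (Suc k)) (x k))\<^sup>2 \<le> c * (E k - E (Suc k))" and c: "c > 0"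
    and r: "strict_mono r" "(x \<circ> r) \<longlonglongrightarrow> p"
    and q: "0 < q" "q < 1" and \<epsilon>: "\<epsilon> > 0"
    and contr: "\<And>k. k \<ge> K \<Longrightarrow> dist (x k) p < \<epsilon> \<Longrightarrow> E (Suc k) \<le> q * E k"
  shows "x \<longlonglongrightarrow> p \<and> (\<exists>M>0. \<exists>Mbar>0. \<forall>k.
           E k \<le> M * q ^ k \<and> dist (x k) p \<le> Mbar * q powr (real k / 2))"
proof -
  define s where "s = sqrt q"
  have s: "0 < s" "s < 1" "s * s = q" using q by (auto simp: s_def)
  define C where "C = sqrt c / (1 - s)"
  have C: "C > 0" "C * (1 - s) = sqrt c" using c s by (auto simp: C_def)
  have len: "dist (x (Suc k)) (x k) \<le> C * sqrt (E k) - C * sqrt (E (Suc k))"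
    if "k \<ge> K" "dist (x k) p < \<epsilon>" for k
  proof -
    have "(dist (x (Suc k)) (x k))\<^sup>2 \<le> c * E k"
      using step[of k] E0[of "Suc k"] c by (simp add: algebra_simps)
        (smt (verit) mult_nonneg_nonneg)
    then have "dist (x (Suc k)) (x k) \<le> sqrt c * sqrt (E k)"
      by (metis real_le_rsqrt real_sqrt_mult)
    also have "\<dots> = C * sqrt (E k) - C * (s * sqrt (E k))"
      unfolding C(2)[symmetric] by (simp add: algebra_simps)
    also have "\<dots> \<le> C * sqrt (E k) - C * sqrt (E (Suc k))"
    proof -
      have "sqrt (E (Suc k)) \<le> s * sqrt (E k)"
        using contr[OF that] by (simp add: s_def flip: real_sqrt_mult)
      then show ?thesis using C(1) by simp
    qed
    finally show ?thesis .
  qed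
  have sqE: "(\<lambda>k. C * sqrt (E k)) \<longlonglongrightarrow> 0"
    using tendsto_mult_left[OF tendsto_real_sqrt[OF Elim], of C] by simp
  have Phi_sub: "(\<lambda>m. dist ((x \<circ> r) m) p + C * sqrt ((E \<circ> r) m)) \<longlonglongrightarrow> dist p p + C * sqrt 0"
    by (intro tendsto_intros r LIMSEQ_subseq_LIMSEQ Elim)
  then have Phi_small: "\<exists>k\<ge>N. dist (x k) p + C * sqrt (E k) < e" if "e > 0" for e N
  proof -
    have "\<forall>\<^sub>F m in sequentially. dist ((x \<circ> r) m) p + C * sqrt ((E \<circ> r) m) < e"
      using order_tendstoD(2)[OF Phi_sub, of e] that by simp
    then obtain N' where "\<And>m. m \<ge> N' \<Longrightarrow> dist ((x \<circ> r) m) p + C * sqrt ((E \<circ> r) m) < e"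
      unfolding eventually_sequentially by blast
    moreover define m where "m = max N N'"
    ultimately have m: "m \<ge> N" "dist ((x \<circ> r) m) p + C * sqrt ((E \<circ> r) m) < e" by auto
    moreover have "r m \<ge> N" using m(1) seq_suble[OF r(1), of m] by simp
    ultimately show ?thesis by (intro exI[of _ "r m"]) simp
  qed
  have trap: "dist (x k) p + C * sqrt (E k) \<le> dist (x n) p + C * sqrt (E n)"
    if "n \<ge> K" "dist (x n) p + C * sqrt (E n) < \<epsilon>" "k \<ge> n" for n k
    using that(3)
  proof (induction k rule: dec_induct)
    case (step k)
    have "0 \<le> C * sqrt (E k)" using C E0 by simp
    then have "dist (x k) p < \<epsilon>" using step that by linarith
    then show ?case
      using len[of k] step that dist_triangle[of "x (Suc k)" p "x k"] by simp
  qed simp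
  obtain n where n: "n \<ge> K" "dist (x n) p + C * sqrt (E n) < \<epsilon>"
    using Phi_small[OF \<epsilon>] by blast
  have near: "dist (x k) p < \<epsilon>" if "k \<ge> n" for k
  proof -
    have "0 \<le> C * sqrt (E k)" using C E0 by simp
    then show ?thesis using trap[OF n that] n by linarith
  qed
  have lim: "x \<longlonglongrightarrow> p"
  proof (rule metric_LIMSEQ_I)
    fix e :: real assume e: "e > 0"
    obtain m where m: "m \<ge> K" "dist (x m) p + C * sqrt (E m) < min e \<epsilon>"
      using Phi_small[of "min e \<epsilon>"] e \<epsilon> by auto
    have "dist (x k) p < e" if "k \<ge> m" for k
    proof -
      have "0 \<le> C * sqrt (E k)" using C E0 by simp
      then show ?thesis using trap[OF m(1) _ that] m by linarith
    qed
    then show "\<exists>N. \<forall>k\<ge>N. dist (x k) p < e" by blast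
  qed
  have dist_le: "dist (x k) p \<le> C * sqrt (E k)" if "k \<ge> n" for k
  proof -
    define \<Psi> where "\<Psi> j = dist (x j) p - C * sqrt (E j)" for j
    have "\<Psi> \<longlonglongrightarrow> dist p p - 0"
      unfolding \<Psi>_def by (intro tendsto_intros lim sqE)
    moreover have "\<Psi> k \<le> \<Psi> j" if "j \<ge> k" for j
      using that
    proof (induction j rule: dec_induct)
      case (step j)
      have "dist (x (Suc j)) (x j) \<le> C * sqrt (E j) - C * sqrt (E (Suc j))"
        using len near n step \<open>k \<ge> n\<close> by simp
      then show ?case
        using step dist_triangle[of "x j" p "x (Suc j)"] by (simp add: \<Psi>_def dist_commute)
    qed simp
    ultimately have "\<Psi> k \<le> 0" by (metis LIMSEQ_le_const diff_0_right dist_self)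
    then show ?thesis by (simp add: \<Psi>_def)
  qed
  define M where "M = (E 0 + 1) / q ^ n"
  have M: "M > 0" using q E0[of 0] by (simp add: M_def add_nonneg_pos)
  have E_rate: "E k \<le> M * q ^ k" for k
  proof (cases "k \<le> n")
    case True
    have "E k \<le> E 0 + 1" using decseqD[OF Edec, of 0 k] by simp
    also have "\<dots> \<le> (E 0 + 1) * (q ^ k / q ^ n)"
    proof -
      have "1 \<le> q ^ k / q ^ n" using True q by (simp add: power_decreasing)
      then show ?thesis
        using E0[of 0] mult_left_mono[of 1 "q ^ k / q ^ n" "E 0 + 1"] by simp
    qed
    finally show ?thesis by (simp add: M_def)
  next
    case False
    then have "n \<le> k" by simp
    then have "E k \<le> M * q ^ k"
    proof (induction k rule: dec_induct)
      case base
      show ?case using decseqD[OF Edec, of 0 n] q by (simp add: M_def)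
    next
      case (step k)
      have "E (Suc k) \<le> q * E k" using contr near n step by simp
      also have "\<dots> \<le> q * (M * q ^ k)" using step q by simp
      finally show ?case by (simp add: algebra_simps)
    qed
    then show ?thesis .
  qed
  have powr: "q powr (real k / 2) = s ^ k" for k
  proof -
    have "q powr (real k / 2) = (q powr (1/2)) powr real k" by (simp add: powr_powr)
    then show ?thesis using q s by (simp add: s_def powr_half_sqrt powr_realpow)
  qed
  obtain D where D: "\<And>k. dist (x k) p \<le> D"
    using convergent_imp_bounded[OF lim] bounded_any_center[of "range x" p]
    by (auto simp: dist_commute)
  have D0: "D \<ge> 0" using D[of 0] zero_le_dist order_trans by blast
  define Mbar where "Mbar = C * sqrt M + (D + 1) / s ^ n"
  have pos: "C * sqrt M > 0" "(D + 1) / s ^ n > 0" using C M D0 s by (auto simp: add_nonneg_pos)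
  have "dist (x k) p \<le> Mbar * s ^ k" for k
  proof (cases "k \<ge> n")
    case True
    have "dist (x k) p \<le> C * sqrt (M * q ^ k)"
      using dist_le[OF True] E_rate[of k] C
      by (meson less_le mult_le_cancel_left_pos order_trans real_sqrt_le_mono)
    also have "\<dots> = C * sqrt M * s ^ k"
      by (simp add: s_def real_sqrt_mult real_sqrt_power)
    also have "\<dots> \<le> Mbar * s ^ k"
      using pos s by (intro mult_right_mono) (auto simp: Mbar_def)
    finally show ?thesis .
  next
    case False
    have "1 \<le> s ^ k / s ^ n" using False s by (simp add: power_decreasing)
    then have "(D + 1) * 1 \<le> (D + 1) * (s ^ k / s ^ n)"
      using D0 by (intro mult_left_mono) auto
    then have "dist (x k) p \<le> (D + 1) / s ^ n * s ^ k" using D[of k] by simp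
    also have "\<dots> \<le> Mbar * s ^ k"
      using pos s by (intro mult_right_mono) (auto simp: Mbar_def)
    finally show ?thesis .
  qed
  moreover have "Mbar > 0" using pos by (simp add: Mbar_def)
  ultimately show ?thesis using lim M E_rate unfolding powr by blast
qed

section \<open>Tangent cones and the geometry of the region\<close>

lemma convex_tangent_cone:
  assumes "convex \<Omega>" "x \<in> \<Omega>"
  shows "convex (tangent_cone \<Omega> x)"
  unfolding tangent_cone_def
proof (rule convex_closure, rule convexI)
  fix w1 w2 :: 'a and u v :: real
  assume uv: "0 \<le> u" "0 \<le> v" "u + v = 1"
    and "w1 \<in> {w. \<exists>t>0. x + t *\<^sub>R w \<in> \<Omega>}" "w2 \<in> {w. \<exists>t>0. x + t *\<^sub>R w \<in> \<Omega>}"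
  then obtain s1 s2 where s: "s1 > 0" "x + s1 *\<^sub>R w1 \<in> \<Omega>" "s2 > 0" "x + s2 *\<^sub>R w2 \<in> \<Omega>" by auto
  define t where "t = min s1 s2"
  have t: "t > 0" "t \<le> s1" "t \<le> s2" using s by (auto simp: t_def)
  have shrink: "x + t *\<^sub>R w \<in> \<Omega>" if "s > 0" "t \<le> s" "x + s *\<^sub>R w \<in> \<Omega>" for s w
  proof -
    have "(1 - t / s) *\<^sub>R x + (t / s) *\<^sub>R (x + s *\<^sub>R w) \<in> \<Omega>"
      using that t assms by (intro convexD_alt) auto
    then show ?thesis using that by (simp add: algebra_simps)
  qed
  have "u *\<^sub>R (x + t *\<^sub>R w1) + v *\<^sub>R (x + t *\<^sub>R w2) \<in> \<Omega>"
    using shrink s t uv by (intro convexD[OF assms(1)]) auto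
  moreover have "u *\<^sub>R (x + t *\<^sub>R w1) + v *\<^sub>R (x + t *\<^sub>R w2) = (u + v) *\<^sub>R x + t *\<^sub>R (u *\<^sub>R w1 + v *\<^sub>R w2)"
    by (simp add: algebra_simps)
  ultimately show "u *\<^sub>R w1 + v *\<^sub>R w2 \<in> {w. \<exists>t>0. x + t *\<^sub>R w \<in> \<Omega>}"
    using uv t by auto
qed

lemma proj_norm_lipschitz:
  assumes "convex \<Omega>" "x \<in> \<Omega>"
  shows "proj_norm \<Omega> x g \<le> proj_norm \<Omega> x h + norm (g - h)"
proof -
  have "0 \<in> {w. \<exists>t>0. x + t *\<^sub>R w \<in> \<Omega>}" using assms by (auto intro: exI[of _ 1])
  then have "tangent_cone \<Omega> x \<noteq> {}"
    unfolding tangent_cone_def using closure_subset by blast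
  then have "dist (closest_point (tangent_cone \<Omega> x) g) (closest_point (tangent_cone \<Omega> x) h) \<le> dist g h"
    using convex_tangent_cone[OF assms] by (intro closest_point_lipschitz) (auto simp: tangent_cone_def)
  then show ?thesis unfolding proj_norm_def dist_norm
    by (smt (verit) norm_triangle_ineq2)
qed

lemma proj_norm_nonneg: "proj_norm \<Omega> x g \<ge> 0"
  by (simp add: proj_norm_def)

lemma mem_descent_ball_iff:
  fixes y :: "'a::real_inner"
  assumes "L > 0"
  shows "y \<in> cball (xbar + (1 / (2 * L)) *\<^sub>R g) (norm g / (2 * L)) \<longleftrightarrow>
         L * (norm (y - xbar))\<^sup>2 \<le> inner g (y - xbar)"
proof -
  let ?v = "y - xbar"
  have "y \<in> cball (xbar + (1 / (2 * L)) *\<^sub>R g) (norm g / (2 * L)) \<longleftrightarrow>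
        norm (?v - (1 / (2 * L)) *\<^sub>R g) \<le> norm g / (2 * L)"
    by (simp add: dist_norm norm_minus_commute diff_diff_eq)
  also have "\<dots> \<longleftrightarrow> (norm (?v - (1 / (2 * L)) *\<^sub>R g))\<^sup>2 \<le> (norm g / (2 * L))\<^sup>2"
    using assms by (simp add: abs_le_square_iff[symmetric])
  also have "(norm (?v - (1 / (2 * L)) *\<^sub>R g))\<^sup>2 =
      (norm ?v)\<^sup>2 - inner g ?v / L + (norm g / (2 * L))\<^sup>2"
  proof -
    have "(norm (v - c *\<^sub>R g))\<^sup>2 = (norm v)\<^sup>2 - 2 * c * inner g v + c\<^sup>2 * (norm g)\<^sup>2" for v :: 'a and c
      unfolding power2_norm_eq_inner
      by (simp add: inner_diff_left inner_diff_right inner_commute power2_eq_square)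
    from this[of ?v "1 / (2 * L)"] show ?thesis by (simp add: power_divide)
  qed
  also have "\<dots> \<le> (norm g / (2 * L))\<^sup>2 \<longleftrightarrow> L * (norm ?v)\<^sup>2 \<le> inner g ?v"
    using assms by (simp add: field_simps)
  finally show ?thesis .
qed

lemma mem_SSC_region_iff:
  assumes "L > 0"
  shows "y \<in> SSC_region L xbar g d \<longleftrightarrow>
    L * (norm (y - xbar))\<^sup>2 \<le> inner g (y - xbar) \<and> L * norm (y - xbar) \<le> inner g (sgn d)"
  unfolding SSC_region_def Int_iff mem_descent_ball_iff[OF assms]
  using assms by (simp add: dist_norm norm_minus_commute field_simps)

text \<open>The region is compact and \<open>d \<noteq> 0\<close>, so the admissible step lengths form a compact set and the
  greatest one is attained.\<close>

lemma SSC_beta_greatest: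
  assumes "y \<in> SSC_region L xbar g d" "d \<noteq> 0"
  shows "SSC_beta L xbar g y d \<ge> 0"
    and "y + SSC_beta L xbar g y d *\<^sub>R d \<in> SSC_region L xbar g d"
    and "\<And>b. b \<ge> 0 \<Longrightarrow> y + b *\<^sub>R d \<in> SSC_region L xbar g d \<Longrightarrow> b \<le> SSC_beta L xbar g y d"
proof -
  let ?R = "SSC_region L xbar g d"
  define T where "T = {b. b \<ge> 0 \<and> y + b *\<^sub>R d \<in> ?R}"
  have R: "compact ?R" unfolding SSC_region_def by (simp add: compact_Int)
  have "closed T"
  proof -
    have "T = {0..} \<inter> (\<lambda>b. y + b *\<^sub>R d) -` ?R" by (auto simp: T_def)
    moreover have "closed ((\<lambda>b. y + b *\<^sub>R d) -` ?R)"
      by (intro closed_vimage compact_imp_closed R continuous_intros)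
    ultimately show ?thesis by (simp add: closed_Int)
  qed
  moreover have "bounded T"
  proof -
    obtain B where B: "\<And>v. v \<in> ?R \<Longrightarrow> norm v \<le> B"
      using compact_imp_bounded[OF R] by (auto simp: bounded_iff)
    have "norm b \<le> (B + norm y) / norm d" if "b \<in> T" for b
    proof -
      have "norm (b *\<^sub>R d) \<le> norm (y + b *\<^sub>R d) + norm y"
        by (metis add.commute add_diff_cancel_left' norm_triangle_ineq4)
      also have "\<dots> \<le> B + norm y" using B that by (auto simp: T_def)
      finally show ?thesis using assms by (simp add: pos_le_divide_eq)
    qed
    then show ?thesis by (auto simp: bounded_iff)
  qed
  moreover have "0 \<in> T" using assms by (simp add: T_def)
  ultimately obtain b where b: "b \<in> T" "\<forall>c\<in>T. c \<le> b"
    using compact_attains_sup[of T] compact_eq_bounded_closed by blast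
  have "SSC_beta L xbar g y d = b"
    using b assms unfolding SSC_beta_def T_def by (auto intro!: Greatest_equality)
  then show "SSC_beta L xbar g y d \<ge> 0" "y + SSC_beta L xbar g y d *\<^sub>R d \<in> ?R"
    "\<And>b. b \<ge> 0 \<Longrightarrow> y + b *\<^sub>R d \<in> ?R \<Longrightarrow> b \<le> SSC_beta L xbar g y d"
    using b by (auto simp: T_def)
qed

text \<open>If both constraints of the region were slack, continuity would allow a longer step.\<close>

lemma SSC_beta_boundary:
  assumes "L > 0" "y \<in> SSC_region L xbar g d" "d \<noteq> 0"
    and z: "z = y + SSC_beta L xbar g y d *\<^sub>R d"
  shows "inner g (sgn d) \<le> L * norm (z - xbar) \<or> inner g (z - xbar) \<le> L * (norm (z - xbar))\<^sup>2"
proof (rule ccontr)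
  define b where "b = SSC_beta L xbar g y d"
  define V where "V = {t. L * norm (y + t *\<^sub>R d - xbar) < inner g (sgn d)} \<inter>
    {t. L * (norm (y + t *\<^sub>R d - xbar))\<^sup>2 < inner g (y + t *\<^sub>R d - xbar)}"
  assume "\<not> ?thesis"
  then have "b \<in> V" by (auto simp: V_def b_def z)
  moreover have "open V"
    unfolding V_def by (intro open_Int open_Collect_less continuous_intros)
  ultimately obtain e where e: "e > 0" "cball b e \<subseteq> V" by (auto simp: open_contains_cball)
  then have "b + e \<in> V" by (auto simp: dist_real_def)
  then have "y + (b + e) *\<^sub>R d \<in> SSC_region L xbar g d"
    by (auto simp: V_def mem_SSC_region_iff[OF assms(1)])
  then have "b + e \<le> b"
    using SSC_beta_greatest(1)[OF assms(2,3)] SSC_beta_greatest(3)[OF assms(2,3), of "b + e"] e(1)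
    by (simp add: b_def)
  then show False using e by simp
qed

section \<open>The inner procedure\<close>

locale SSC_setting =
  fixes \<Omega> :: "'a::euclidean_space set" and f :: "'a \<Rightarrow> real" and gradf :: "'a \<Rightarrow> 'a"
    and L \<tau> :: real and A :: "'a \<Rightarrow> 'a \<Rightarrow> 'a set" and S :: "'a \<Rightarrow> 'a \<Rightarrow> 'a \<Rightarrow> real set"
  assumes cvx: "convex \<Omega>"
    and gderiv: "\<And>u. u \<in> \<Omega> \<Longrightarrow> GDERIV f u :> gradf u"
    and L: "L > 0"
    and lip: "\<And>u v. u \<in> \<Omega> \<Longrightarrow> v \<in> \<Omega> \<Longrightarrow> norm (gradf u - gradf v) \<le> L * norm (u - v)"
    and directions: "direction_method \<Omega> A" and stepsizes: "stepsize_rule \<Omega> A S"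
    and angle: "SB \<Omega> A = \<tau>" and \<tau>: "\<tau> > 0"
begin

lemma DERIV_along_line:
  assumes "y + t *\<^sub>R d \<in> \<Omega>"
  shows "((\<lambda>t. f (y + t *\<^sub>R d)) has_real_derivative inner (gradf (y + t *\<^sub>R d)) d) (at t)"
proof -
  have "((\<lambda>t. y + t *\<^sub>R d) has_derivative (\<lambda>h. h *\<^sub>R d)) (at t)"
    by (auto intro!: derivative_eq_intros)
  from diff_chain_at[OF this gderiv[OF assms, unfolded gderiv_def]]
  show ?thesis
    by (simp add: has_field_derivative_def o_def inner_commute mult.commute[of _ "inner _ _"])
qed

lemma descent_lemma:
  assumes "u \<in> \<Omega>" "v \<in> \<Omega>"
  shows "f v \<le> f u + inner (gradf u) (v - u) + L / 2 * (norm (v - u))\<^sup>2"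
proof -
  define d where "d = v - u"
  define \<phi> where "\<phi> t = f (u + t *\<^sub>R d) - t * inner (gradf u) d - L / 2 * t\<^sup>2 * (norm d)\<^sup>2" for t
  have "\<exists>y. DERIV \<phi> t :> y \<and> y \<le> 0" if t: "0 \<le> t" "t \<le> 1" for t
  proof -
    have "(1 - t) *\<^sub>R u + t *\<^sub>R v \<in> \<Omega>" using cvx assms t by (intro convexD_alt) auto
    then have mem: "u + t *\<^sub>R d \<in> \<Omega>" by (simp add: d_def algebra_simps)
    have "DERIV \<phi> t :> inner (gradf (u + t *\<^sub>R d)) d - inner (gradf u) d - L * t * (norm d)\<^sup>2"
      unfolding \<phi>_def by (auto intro!: derivative_eq_intros DERIV_along_line[OF mem])
    moreover have "inner (gradf (u + t *\<^sub>R d) - gradf u) d \<le> L * norm (t *\<^sub>R d) * norm d"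
    proof -
      have "inner (gradf (u + t *\<^sub>R d) - gradf u) d \<le> norm (gradf (u + t *\<^sub>R d) - gradf u) * norm d"
        by (rule norm_cauchy_schwarz)
      also have "\<dots> \<le> L * norm (t *\<^sub>R d) * norm d"
        using lip[OF mem assms(1)] by (intro mult_right_mono) auto
      finally show ?thesis .
    qed
    moreover have "inner (gradf (u + t *\<^sub>R d) - gradf u) d =
        inner (gradf (u + t *\<^sub>R d)) d - inner (gradf u) d" by (rule inner_diff_left)
    moreover have "L * norm (t *\<^sub>R d) * norm d = L * t * (norm d)\<^sup>2"
      using t by (simp add: power2_eq_square)
    ultimately show ?thesis by (smt (verit))
  qed
  then have "\<phi> 1 \<le> \<phi> 0" using DERIV_nonpos_imp_nonincreasing[of 0 1 \<phi>] by (metis zero_le_one)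
  then show ?thesis by (simp add: \<phi>_def d_def)
qed

lemma descent_in_ball:
  assumes "xbar \<in> \<Omega>" "y \<in> \<Omega>" "L * (norm (y - xbar))\<^sup>2 \<le> inner (- gradf xbar) (y - xbar)"
  shows "f y \<le> f xbar - L / 2 * (norm (y - xbar))\<^sup>2"
  using descent_lemma[OF assms(1,2)] assms(3) by simp

lemma direction_ascent:
  assumes "y \<in> \<Omega>" "d \<in> A y g" "d \<noteq> 0"
  shows "inner g d > 0"
  using directions assms unfolding direction_method_def by blast

lemma zero_direction:
  assumes "y \<in> \<Omega>" "0 \<in> A y g"
  shows "proj_norm \<Omega> y g = 0"
  using directions assms unfolding direction_method_def by meson

lemma slope_ge:
  assumes y: "y \<in> \<Omega>" and d: "d \<in> A y g" "d \<noteq> 0"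
  shows "\<tau> * proj_norm \<Omega> y g \<le> inner g (sgn d)"
proof -
  have quot: "0 \<le> inner h e / (proj_norm \<Omega> u h * norm e)" if "u \<in> \<Omega>" "e \<in> A u h" for u h e
    using direction_ascent[OF that] by (cases "e = 0") (auto simp: proj_norm_nonneg)
  have ne: "A u h \<noteq> {}" if "u \<in> \<Omega>" for u h
    using directions that unfolding direction_method_def by (metis insert_not_empty)
  have "0 \<le> DSB \<Omega> A u h" if "u \<in> \<Omega>" for u h
    unfolding DSB_def using quot ne that by (auto intro!: cINF_greatest)
  then have "bdd_below ((\<lambda>(u, h). DSB \<Omega> A u h) ` (\<Omega> \<times> UNIV))" by (intro bdd_belowI[of _ 0]) auto
  then have "SB \<Omega> A \<le> (\<lambda>(u, h). DSB \<Omega> A u h) (y, g)"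
    unfolding SB_def using y by (intro cINF_lower) auto
  then have \<tau>_le: "\<tau> \<le> DSB \<Omega> A y g" using angle by simp
  have pos: "proj_norm \<Omega> y g > 0"
    using directions y d proj_norm_nonneg[of \<Omega> y g] unfolding direction_method_def
    by (metis empty_iff insert_iff less_le)
  have "DSB \<Omega> A y g \<le> inner g d / (proj_norm \<Omega> y g * norm d)"
    unfolding DSB_def using pos d quot[OF y] by (auto intro!: cINF_lower bdd_belowI2[of _ 0])
  with \<tau>_le have "\<tau> \<le> inner g d / (proj_norm \<Omega> y g * norm d)" by simp
  then show ?thesis using pos d by (simp add: sgn_div_norm field_simps)
qed

text \<open>Inside the second ball the gradient differs from \<open>gradf xbar\<close> by at most \<open>inner g (sgn d)\<close>, so
  the slope of \<open>f\<close> along \<open>d\<close> cannot become positive.\<close>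

lemma inner_step:
  assumes xbar: "xbar \<in> \<Omega>" and g: "g = - gradf xbar"
    and y: "y \<in> \<Omega>" "y \<in> SSC_region L xbar g d"
    and d: "d \<in> A y g" "d \<noteq> 0" "amax \<in> S y g d"
    and \<alpha>: "0 \<le> \<alpha>" "\<alpha> \<le> amax" "\<alpha> \<le> SSC_beta L xbar g y d"
  shows "y + \<alpha> *\<^sub>R d \<in> \<Omega>" "y + \<alpha> *\<^sub>R d \<in> SSC_region L xbar g d" "f (y + \<alpha> *\<^sub>R d) \<le> f y"
proof -
  let ?R = "SSC_region L xbar g d"
  have mem: "y + t *\<^sub>R d \<in> \<Omega>" if "0 \<le> t" "t \<le> \<alpha>" for t
    using stepsizes y d \<alpha> that unfolding stepsize_rule_def by force
  have "convex ?R" unfolding SSC_region_def by (simp add: convex_Int)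
  have region: "y + t *\<^sub>R d \<in> ?R" if t: "0 \<le> t" "t \<le> \<alpha>" for t
  proof (cases "t = 0")
    case False
    let ?b = "SSC_beta L xbar g y d"
    have b: "?b > 0" "t \<le> ?b" using False t \<alpha> by auto
    have "(1 - t / ?b) *\<^sub>R y + (t / ?b) *\<^sub>R (y + ?b *\<^sub>R d) \<in> ?R"
      using b t SSC_beta_greatest(2)[OF y(2) d(2)] y \<open>convex ?R\<close> by (intro convexD_alt) auto
    then show ?thesis using b by (simp add: algebra_simps)
  qed (use y in simp)
  have "\<exists>s. DERIV (\<lambda>t. f (y + t *\<^sub>R d)) t :> s \<and> s \<le> 0" if t: "0 \<le> t" "t \<le> \<alpha>" for t
  proof -
    let ?v = "y + t *\<^sub>R d"
    have "inner (gradf ?v - gradf xbar) d \<le> norm (gradf ?v - gradf xbar) * norm d"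
      by (rule norm_cauchy_schwarz)
    also have "\<dots> \<le> inner g (sgn d) * norm d"
      using lip[OF mem[OF t] xbar] region[OF t] by (intro mult_right_mono) (auto simp: mem_SSC_region_iff[OF L])
    also have "\<dots> = inner g d" using d by (simp add: sgn_div_norm)
    finally have "inner (gradf ?v) d \<le> 0" by (simp add: g inner_diff_left)
    then show ?thesis using DERIV_along_line[OF mem[OF t]] by blast
  qed
  then have "f (y + \<alpha> *\<^sub>R d) \<le> f (y + 0 *\<^sub>R d)"
    using DERIV_nonpos_imp_nonincreasing[of 0 \<alpha> "\<lambda>t. f (y + t *\<^sub>R d)"] \<alpha>(1) by metis
  then show "f (y + \<alpha> *\<^sub>R d) \<le> f y" by simp
  show "y + \<alpha> *\<^sub>R d \<in> \<Omega>" "y + \<alpha> *\<^sub>R d \<in> ?R" using mem region \<alpha> by auto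
qed

text \<open>The number \<open>m\<close> is the smallest slope \<open>inner g (sgn d)\<close> met on the inner path from \<open>xbar\<close> to \<open>y\<close>, and
  \<open>xt\<close> is the inner iterate at which it is met.  The last clause is the trace that the whole path
  leaves: its displacement is a nonnegative combination of directions of slope at least \<open>m\<close>.\<close>

definition least_slope :: "'a \<Rightarrow> 'a \<Rightarrow> 'a \<Rightarrow> 'a \<Rightarrow> real \<Rightarrow> bool" where
  "least_slope xbar g y xt m \<longleftrightarrow>
     xt \<in> \<Omega> \<and> L * (norm (xt - xbar))\<^sup>2 \<le> inner g (xt - xbar) \<and> L * norm (xt - xbar) \<le> m \<and>
     \<tau> * proj_norm \<Omega> xt g \<le> m \<and> f y \<le> f xt \<and> m * norm (y - xbar) \<le> inner g (y - xbar)"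

definition inner_iterate :: "'a \<Rightarrow> 'a \<Rightarrow> 'a \<Rightarrow> bool" where
  "inner_iterate xbar g y \<longleftrightarrow>
     y \<in> \<Omega> \<and> L * (norm (y - xbar))\<^sup>2 \<le> inner g (y - xbar) \<and>
     (y = xbar \<or> 0 < inner g (y - xbar) \<and> (\<exists>xt m. least_slope xbar g y xt m))"

text \<open>Either the slope of the new direction is a new minimum, and the current iterate becomes the
  witness, or the old minimum persists; in both cases the displacement bound is additive.\<close>

lemma least_slope_step:
  assumes xbar: "xbar \<in> \<Omega>" and g: "g = - gradf xbar"
    and inv: "inner_iterate xbar g y" and reg: "y \<in> SSC_region L xbar g d"
    and d: "d \<in> A y g" "d \<noteq> 0" "amax \<in> S y g d"
    and \<alpha>: "0 \<le> \<alpha>" "\<alpha> \<le> amax" "\<alpha> \<le> SSC_beta L xbar g y d"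
    and moving: "y = xbar \<Longrightarrow> \<alpha> > 0"
    and z: "z = y + \<alpha> *\<^sub>R d"
  shows "0 < inner g (z - xbar) \<and> (\<exists>xt m. least_slope xbar g z xt m)"
proof
  have y: "y \<in> \<Omega>" using inv by (simp add: inner_iterate_def)
  note step = inner_step[OF xbar g y reg d \<alpha>, folded z]
  let ?m = "inner g (sgn d)"
  have gd: "inner g d > 0" using direction_ascent[OF y d(1,2)] .
  have split: "inner g (z - xbar) = inner g (y - xbar) + \<alpha> * inner g d"
    by (simp add: z inner_diff_right inner_add_right)
  have y_nonneg: "0 \<le> inner g (y - xbar)" using inv by (auto simp: inner_iterate_def)
  show "0 < inner g (z - xbar)"
    using moving inv split gd \<alpha>(1) by (auto simp: inner_iterate_def add_pos_nonneg)
  have displacement: "m * norm (z - xbar) \<le> inner g (z - xbar)"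
    if m: "0 \<le> m" "m \<le> ?m" "m * norm (y - xbar) \<le> inner g (y - xbar)" for m
  proof -
    have "norm (z - xbar) \<le> norm (y - xbar) + \<alpha> * norm d"
      using norm_triangle_ineq[of "y - xbar" "\<alpha> *\<^sub>R d"] \<alpha>(1) by (simp add: z algebra_simps)
    then have "m * norm (z - xbar) \<le> m * norm (y - xbar) + m * (\<alpha> * norm d)"
      using m(1) by (simp add: distrib_left[symmetric] mult_left_mono)
    also have "m * (\<alpha> * norm d) \<le> ?m * (\<alpha> * norm d)"
      using m \<alpha> by (intro mult_right_mono) auto
    also have "\<dots> = \<alpha> * inner g d" using d by (simp add: sgn_div_norm)
    finally show ?thesis using m(3) split by linarith
  qed
  have m0: "0 \<le> ?m" using gd by (simp add: sgn_div_norm)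
  have current: "least_slope xbar g z y ?m" if "?m * norm (y - xbar) \<le> inner g (y - xbar)"
    using displacement[OF m0 _ that] y step reg slope_ge[OF y d(1,2)]
    by (simp add: least_slope_def mem_SSC_region_iff[OF L])
  show "\<exists>xt m. least_slope xbar g z xt m"
  proof (cases "y = xbar")
    case True
    then show ?thesis using current by auto
  next
    case False
    then obtain xt m where old: "least_slope xbar g y xt m"
      using inv by (auto simp: inner_iterate_def)
    show ?thesis
    proof (cases "?m \<le> m")
      case True
      have "?m * norm (y - xbar) \<le> m * norm (y - xbar)" using True by (simp add: mult_right_mono)
      then show ?thesis using current old by (auto simp: least_slope_def)
    next
      case False
      have "0 \<le> L * norm (xt - xbar)" using L by simp
      then have "0 \<le> m" using old unfolding least_slope_def by linarith
      then have "least_slope xbar g z xt m"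
        using old False displacement[of m] step by (simp add: least_slope_def)
      then show ?thesis by blast
    qed
  qed
qed

lemma inner_iterate_SSC_next:
  assumes xbar: "xbar \<in> \<Omega>" and g: "g = - gradf xbar"
    and inv: "inner_iterate xbar g y" and nxt: "SSC_next A S L xbar g y z"
  shows "inner_iterate xbar g z"
proof -
  from nxt obtain d amax where d: "d \<in> A y g" "d \<noteq> 0" "amax \<in> S y g d"
    and lt: "amax < SSC_beta L xbar g y d" and z: "z = y + amax *\<^sub>R d"
    unfolding SSC_next_def by (auto simp: min_def split: if_splits)
  have y: "y \<in> \<Omega>" using inv by (simp add: inner_iterate_def)
  have amax: "amax > 0" using stepsizes y d unfolding stepsize_rule_def by blast
  have reg: "y \<in> SSC_region L xbar g d"
    using lt amax by (auto simp: SSC_beta_def split: if_splits)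
  note facts = xbar g inv reg d
  show ?thesis
    using least_slope_step[OF facts _ _ _ _ z] inner_step[OF xbar g y reg d, of amax] amax lt
    unfolding inner_iterate_def z by (simp add: mem_SSC_region_iff[OF L])
qed

text \<open>An inner iterate \<open>xt\<close> where the slope is small compared with the outer step, and which is not
  farther from \<open>xbar\<close> than \<open>z\<close>, is nearly stationary, since its own gradient is close to that at
  \<open>xbar\<close>.\<close>

lemma near_stationary:
  assumes "xbar \<in> \<Omega>" "xt \<in> \<Omega>" "norm (xt - xbar) \<le> norm (z - xbar)"
    and "\<tau> * proj_norm \<Omega> xt (- gradf xbar) \<le> L * norm (z - xbar)"
  shows "\<tau> * proj_norm \<Omega> xt (- gradf xt) \<le> L * (1 + \<tau>) * norm (z - xbar)"
proof -
  have "norm (- gradf xt - - gradf xbar) \<le> L * norm (xt - xbar)"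
    using lip[OF assms(1,2)] by (simp add: norm_minus_commute)
  also have "\<dots> \<le> L * norm (z - xbar)" using assms L by simp
  finally have "proj_norm \<Omega> xt (- gradf xt) \<le> proj_norm \<Omega> xt (- gradf xbar) + L * norm (z - xbar)"
    using proj_norm_lipschitz[OF cvx assms(2), of "- gradf xt" "- gradf xbar"] by linarith
  then have "\<tau> * proj_norm \<Omega> xt (- gradf xt) \<le>
      \<tau> * (proj_norm \<Omega> xt (- gradf xbar) + L * norm (z - xbar))"
    using \<tau> by simp
  then show ?thesis using assms(4) by (simp add: algebra_simps)
qed

text \<open>The procedure may return for four reasons: the direction is zero, the iterate already lies
  outside the second ball, the maximal step ends on the sphere of the second ball, or it ends on that of
  the first.  In the first two cases the returned point itself is nearly stationary, in the third the
  last inner iterate, in the fourth the iterate of least slope.\<close>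

lemma SSC_decrease:
  assumes xbar: "xbar \<in> \<Omega>" and ssc: "SSC A S L xbar (- gradf xbar) z"
  shows "z \<in> \<Omega> \<and> f z \<le> f xbar - L / 2 * (norm (z - xbar))\<^sup>2 \<and>
    (\<exists>xt\<in>\<Omega>. f z \<le> f xt \<and> f xt \<le> f xbar \<and> norm (xt - xbar) \<le> norm (z - xbar) \<and>
       \<tau> * proj_norm \<Omega> xt (- gradf xt) \<le> L * (1 + \<tau>) * norm (z - xbar))"
proof -
  define g where "g = - gradf xbar"
  obtain y where path: "(SSC_next A S L xbar g)\<^sup>*\<^sup>* xbar y" and ret: "SSC_return A S L xbar g y z"
    using ssc[folded g_def] unfolding SSC_def by (elim exE conjE)
  from path have inv: "inner_iterate xbar g y"
  proof (induction rule: rtranclp_induct)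
    case base
    then show ?case using xbar by (simp add: inner_iterate_def)
  next
    case (step y z)
    then show ?case using inner_iterate_SSC_next[OF xbar g_def] by blast
  qed
  have y: "y \<in> \<Omega>" and y_ball: "L * (norm (y - xbar))\<^sup>2 \<le> inner g (y - xbar)"
    using inv by (auto simp: inner_iterate_def)
  have ball_decrease: "f v \<le> f xbar - L / 2 * (norm (v - xbar))\<^sup>2" "f v \<le> f xbar"
    if "v \<in> \<Omega>" "L * (norm (v - xbar))\<^sup>2 \<le> inner g (v - xbar)" for v
  proof -
    show *: "f v \<le> f xbar - L / 2 * (norm (v - xbar))\<^sup>2"
      using descent_in_ball[OF xbar that(1)] that(2) by (simp add: g_def)
    have "0 \<le> L / 2 * (norm (v - xbar))\<^sup>2" using L by simp
    then show "f v \<le> f xbar" using * by linarith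
  qed
  have conclude: ?thesis
    if "z \<in> \<Omega>" "L * (norm (z - xbar))\<^sup>2 \<le> inner g (z - xbar)"
      and "xt \<in> \<Omega>" "L * (norm (xt - xbar))\<^sup>2 \<le> inner g (xt - xbar)" "f z \<le> f xt"
      and "norm (xt - xbar) \<le> norm (z - xbar)" "\<tau> * proj_norm \<Omega> xt g \<le> L * norm (z - xbar)" for xt
    using ball_decrease(1)[OF that(1,2)] ball_decrease(2)[OF that(3,4)] that
      near_stationary[OF xbar that(3,6)] by (auto simp: g_def)
  show ?thesis
  proof (cases "0 \<in> A y g \<and> z = y")
    case True
    then show ?thesis using conclude[of y] y y_ball zero_direction[OF y] L by simp
  next
    case False
    then obtain d amax where d: "d \<in> A y g" "d \<noteq> 0" "amax \<in> S y g d"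
      and le: "SSC_beta L xbar g y d \<le> amax" and z: "z = y + SSC_beta L xbar g y d *\<^sub>R d"
      using ret unfolding SSC_return_def by (auto simp: min_def split: if_splits)
    have slope: "\<tau> * proj_norm \<Omega> y g \<le> inner g (sgn d)" by (rule slope_ge[OF y d(1,2)])
    show ?thesis
    proof (cases "y \<in> SSC_region L xbar g d")
      case False
      then have "z = y" by (simp add: z SSC_beta_def)
      moreover have "inner g (sgn d) \<le> L * norm (y - xbar)"
        using False y_ball by (simp add: mem_SSC_region_iff[OF L])
      ultimately show ?thesis using conclude[of y] y y_ball slope by simp
    next
      case reg: True
      note beta = SSC_beta_greatest[OF reg d(2)]
      note step = inner_step[OF xbar g_def y reg d beta(1) le order_refl, folded z]
      have z_ball: "L * (norm (z - xbar))\<^sup>2 \<le> inner g (z - xbar)"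
        and y_near: "L * norm (y - xbar) \<le> inner g (sgn d)"
        using step(2) reg by (simp_all add: mem_SSC_region_iff[OF L])
      from SSC_beta_boundary[OF L reg d(2) z] show ?thesis
      proof
        assume far: "inner g (sgn d) \<le> L * norm (z - xbar)"
        then have "L * norm (y - xbar) \<le> L * norm (z - xbar)" using y_near by linarith
        then have "norm (y - xbar) \<le> norm (z - xbar)" using L by simp
        then show ?thesis using conclude[of y] step z_ball y y_ball slope far by simp
      next
        assume edge: "inner g (z - xbar) \<le> L * (norm (z - xbar))\<^sup>2"
        \<comment> \<open>From \<open>xbar\<close> both constraints bind at the same step length \<open>b\<close>, which is positive, so
          the first step is never null.\<close>
        have "SSC_beta L xbar g y d > 0" if "y = xbar"
        proof -
          define b where "b = inner g d / (L * (norm d)\<^sup>2)"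
          have "inner g d > 0" by (rule direction_ascent[OF y d(1,2)])
          then have "b > 0" using L d by (simp add: b_def)
          have gd: "inner g d = L * b * (norm d)\<^sup>2" using L d by (simp add: b_def)
          have "y + b *\<^sub>R d \<in> SSC_region L xbar g d"
            using \<open>b > 0\<close> d gd that
            by (simp add: mem_SSC_region_iff[OF L] sgn_div_norm power2_eq_square field_simps)
          then show ?thesis using beta(3)[of b] \<open>b > 0\<close> by simp
        qed
        then obtain xt m where pos: "0 < inner g (z - xbar)" and ls: "least_slope xbar g z xt m"
          using least_slope_step[OF xbar g_def inv reg d beta(1) le order_refl _ z] by blast
        have "norm (z - xbar) > 0" using pos by auto
        moreover have "m * norm (z - xbar) \<le> (L * norm (z - xbar)) * norm (z - xbar)"
          using ls edge by (simp add: least_slope_def power2_eq_square)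
        ultimately have m: "m \<le> L * norm (z - xbar)" using mult_le_cancel_right_pos by blast
        then have "L * norm (xt - xbar) \<le> L * norm (z - xbar)"
          using ls by (simp add: least_slope_def)
        then show ?thesis using conclude[of xt] ls m step z_ball L by (simp add: least_slope_def)
      qed
    qed
  qed
qed

text \<open>The objective at \<open>xt\<close> lies between the values at both ends of the step.  Therefore the KL inequality
  at \<open>xt\<close> bounds the step from below in terms of the remaining gap, and the step in turn bounds the
  decrease.\<close>

lemma KL_contraction:
  assumes dec: "f z \<le> f xbar - L / 2 * D\<^sup>2"
    and xt: "f z \<le> f xt" "\<tau> * proj_norm \<Omega> xt (- gradf xt) \<le> L * (1 + \<tau>) * D"
    and KL: "f p < f xt \<Longrightarrow> proj_norm \<Omega> xt (- gradf xt) \<ge> sqrt (2 * \<mu>) * sqrt (f xt - f p)"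
    and p: "f p \<le> f z" and \<mu>: "\<mu> > 0"
  shows "f z - f p \<le> inverse (1 + (\<mu> / L) * (\<tau>\<^sup>2 / (1 + \<tau>)\<^sup>2)) * (f xbar - f p)"
proof -
  let ?w = "(\<mu> / L) * (\<tau>\<^sup>2 / (1 + \<tau>)\<^sup>2)"
  have "sqrt (2 * \<mu>) * sqrt (f xt - f p) \<le> proj_norm \<Omega> xt (- gradf xt)"
  proof (cases "f p < f xt")
    case False
    then have "f xt - f p = 0" using xt(1) p by linarith
    then show ?thesis by (simp add: proj_norm_nonneg)
  qed (rule KL)
  then have "\<tau> * (sqrt (2 * \<mu>) * sqrt (f xt - f p)) \<le> \<tau> * proj_norm \<Omega> xt (- gradf xt)"
    using \<tau> by simp
  also have "\<dots> \<le> L * (1 + \<tau>) * D" by (rule xt(2))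
  finally have "(\<tau> * (sqrt (2 * \<mu>) * sqrt (f xt - f p)))\<^sup>2 \<le> (L * (1 + \<tau>) * D)\<^sup>2"
    using \<tau> \<mu> xt(1) p by (intro power_mono) auto
  then have "\<tau>\<^sup>2 * (2 * \<mu> * (f xt - f p)) \<le> L\<^sup>2 * (1 + \<tau>)\<^sup>2 * D\<^sup>2"
    using \<mu> xt(1) p by (simp add: power_mult_distrib)
  also have "\<dots> = 2 * L * (1 + \<tau>)\<^sup>2 * (L / 2 * D\<^sup>2)" by (simp add: power2_eq_square)
  also have "\<dots> \<le> 2 * L * (1 + \<tau>)\<^sup>2 * (f xbar - f z)" using dec L by (intro mult_left_mono) auto
  finally have "\<tau>\<^sup>2 * \<mu> * (f xt - f p) \<le> L * (1 + \<tau>)\<^sup>2 * (f xbar - f z)" by simp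
  then have "?w * (f xt - f p) \<le> f xbar - f z"
    using L \<tau> by (simp add: divide_simps mult_ac)
  moreover have w: "?w > 0" using L \<tau> \<mu> by simp
  moreover have "?w * (f z - f p) \<le> ?w * (f xt - f p)" using xt(1) w by (intro mult_left_mono) auto
  ultimately have "(1 + ?w) * (f z - f p) \<le> f xbar - f p" by (simp add: distrib_right)
  moreover have "1 + ?w > 0" using w by linarith
  moreover have "a \<le> inverse v * b" if "v * a \<le> b" "v > 0" for a b v :: real
    using that by (simp add: field_simps)
  ultimately show ?thesis by blast
qed

end

section \<open>The outer iteration\<close>

theorem corollary4p2:
  fixes \<Omega> :: "'a::euclidean_space set"
    and f :: "'a \<Rightarrow> real" and gradf :: "'a \<Rightarrow> 'a"
    and L \<tau> \<mu> q :: real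
    and A :: "'a \<Rightarrow> 'a \<Rightarrow> 'a set"
    and S :: "'a \<Rightarrow> 'a \<Rightarrow> 'a \<Rightarrow> real set"
    and x :: "nat \<Rightarrow> 'a"
  assumes "compact \<Omega>" and "convex \<Omega>"
    and "C1_near \<Omega> f gradf"
    and "L > 0" and "\<forall>u\<in>\<Omega>. \<forall>v\<in>\<Omega>. norm (gradf u - gradf v) \<le> L * norm (u - v)"
    and "direction_method \<Omega> A" and "stepsize_rule \<Omega> A S"
    and "SB \<Omega> A = \<tau>" and "\<tau> > 0"
    and "SSC_terminates \<Omega> gradf A S L"
    and "first_order_SSC \<Omega> gradf A S L x"
    and "\<mu> > 0" and "\<forall>p\<in>limit_set x. KL_condition \<Omega> f gradf \<mu> p"
    and "q = inverse (1 + (\<mu> / L) * (\<tau>\<^sup>2 / (1 + \<tau>)\<^sup>2))"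
  shows "\<exists>xs\<in>\<Omega>. x \<longlonglongrightarrow> xs \<and>
           (\<exists>M>0. \<exists>Mbar>0. \<forall>k.
              f (x k) - f xs \<le> M * q ^ k \<and>
              norm (x k - xs) \<le> Mbar * q powr (real k / 2))"
proof -
  interpret SSC_setting \<Omega> f gradf L \<tau> A S
    using assms by unfold_locales (auto simp: C1_near_def)
  note L = \<open>L > 0\<close>
  let ?D = "\<lambda>k. norm (x (Suc k) - x k)"
  define good where "good k xt \<longleftrightarrow> xt \<in> \<Omega> \<and> f (x (Suc k)) \<le> f xt \<and> f xt \<le> f (x k) \<and>
      norm (xt - x k) \<le> ?D k \<and> \<tau> * proj_norm \<Omega> xt (- gradf xt) \<le> L * (1 + \<tau>) * ?D k" for k xt
  have iter: "x (Suc k) \<in> \<Omega> \<and> f (x (Suc k)) \<le> f (x k) - L / 2 * (?D k)\<^sup>2 \<and> (\<exists>xt. good k xt)"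
    if "x k \<in> \<Omega>" for k
  proof (cases "stationary \<Omega> gradf (x k)")
    case True
    then have "x (Suc k) = x k" using assms(11) by (simp add: first_order_SSC_def)
    then show ?thesis using that True by (auto simp: good_def stationary_def intro!: exI[of _ "x k"])
  next
    case False
    then have "SSC A S L (x k) (- gradf (x k)) (x (Suc k))"
      using assms(11) by (simp add: first_order_SSC_def)
    then show ?thesis using SSC_decrease[OF that] by (auto simp: good_def)
  qed
  have mem: "x k \<in> \<Omega>" for k
  proof (induction k)
    case 0
    then show ?case using assms(11) by (simp add: first_order_SSC_def)
  next
    case (Suc k)
    then show ?case using iter by blast
  qed
  have dec: "f (x (Suc k)) \<le> f (x k) - L / 2 * (?D k)\<^sup>2" and good: "\<exists>xt. good k xt" for k
    using iter[OF mem] by auto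
  obtain p r where p: "p \<in> \<Omega>" and r: "strict_mono r" "(x \<circ> r) \<longlonglongrightarrow> p"
    using \<open>compact \<Omega>\<close> mem unfolding compact_def by blast
  define E where "E k = f (x k) - f p" for k
  have "isCont f p"
    using gderiv[OF p] by (auto simp: gderiv_def intro: has_derivative_continuous)
  then have sub: "(E \<circ> r) \<longlonglongrightarrow> 0"
    using isCont_tendsto_compose[OF _ r(2), of f] LIM_zero by (simp add: E_def o_def)
  have "E (Suc k) \<le> E k" for k
  proof -
    have "0 \<le> L / 2 * (?D k)\<^sup>2" using L by simp
    then show ?thesis using dec[of k] unfolding E_def by linarith
  qed
  then have Edec: "decseq E" by (rule decseq_SucI)
  have E0: "0 \<le> E k" for k
  proof (rule LIMSEQ_le_const2[OF sub])
    have "(E \<circ> r) n \<le> E k" if "n \<ge> k" for n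
      using decseqD[OF Edec, of k "r n"] seq_suble[OF r(1), of n] that by simp
    then show "\<exists>N. \<forall>n\<ge>N. (E \<circ> r) n \<le> E k" by blast
  qed
  have Elim: "E \<longlonglongrightarrow> 0"
  proof -
    obtain l where l: "E \<longlonglongrightarrow> l" using decseq_convergent[OF Edec, of 0] E0 by blast
    then show ?thesis using LIMSEQ_unique[OF LIMSEQ_subseq_LIMSEQ[OF l r(1)] sub] by simp
  qed
  have "KL_condition \<Omega> f gradf \<mu> p" using assms(13) r by (auto simp: limit_set_def)
  then obtain \<eta> \<delta> where \<eta>: "\<eta> > 0" and \<delta>: "\<delta> > 0"
    and KL: "\<And>v. v \<in> \<Omega> \<Longrightarrow> norm (v - p) < \<delta> \<Longrightarrow> f p < f v \<Longrightarrow> f v < f p + \<eta> \<Longrightarrow>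
        proj_norm \<Omega> v (- gradf v) \<ge> sqrt (2 * \<mu>) * sqrt (f v - f p)"
    unfolding KL_condition_def by blast
  \<comment> \<open>The second bound on the gap forces steps shorter than \<open>\<delta> / 2\<close>, so that the intermediate
    iterate stays in the KL ball when \<open>x k\<close> is within \<open>\<delta> / 2\<close> of \<open>p\<close>.\<close>
  have "\<forall>\<^sub>F k in sequentially. E k < min \<eta> (L / 2 * (\<delta> / 2)\<^sup>2)"
    by (rule order_tendstoD(2)[OF Elim]) (use \<eta> \<delta> L in simp)
  then obtain K where K: "\<And>k. k \<ge> K \<Longrightarrow> E k < \<eta> \<and> E k < L / 2 * (\<delta> / 2)\<^sup>2"
    unfolding eventually_sequentially by auto
  have contr: "E (Suc k) \<le> q * E k" if k: "k \<ge> K" "dist (x k) p < \<delta> / 2" for k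
  proof -
    obtain xt where xt: "good k xt" using good by blast
    have "L / 2 * (?D k)\<^sup>2 < L / 2 * (\<delta> / 2)\<^sup>2"
      using dec[of k] E0[of "Suc k"] K[OF k(1)] by (simp add: E_def)
    then have "(?D k)\<^sup>2 < (\<delta> / 2)\<^sup>2" using L by simp
    then have "?D k < \<delta> / 2" by (rule power2_less_imp_less) (use \<delta> in simp)
    then have close: "norm (xt - p) < \<delta>"
      using xt k(2) norm_triangle_ineq[of "xt - x k" "x k - p"] by (simp add: good_def dist_norm)
    have "f xt < f p + \<eta>" using xt K[OF k(1)] by (simp add: good_def E_def)
    then have "f p < f xt \<Longrightarrow> proj_norm \<Omega> xt (- gradf xt) \<ge> sqrt (2 * \<mu>) * sqrt (f xt - f p)"
      using KL[OF _ close] xt by (simp add: good_def)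
    then show ?thesis
      using KL_contraction[OF dec[of k], of xt p \<mu>] xt E0[of "Suc k"] \<open>\<mu> > 0\<close>
      by (simp add: good_def E_def assms(14))
  qed
  have q: "0 < q" "q < 1"
  proof -
    have "1 + (\<mu> / L) * (\<tau>\<^sup>2 / (1 + \<tau>)\<^sup>2) > 1" using L \<open>\<tau> > 0\<close> \<open>\<mu> > 0\<close> by simp
    then show "0 < q" "q < 1"
      unfolding assms(14) using one_less_inverse_iff inverse_less_1_iff by force+
  qed
  have step: "(dist (x (Suc k)) (x k))\<^sup>2 \<le> 2 / L * (E k - E (Suc k))" for k
    using dec[of k] L by (simp add: E_def dist_norm field_simps)
  have "x \<longlonglongrightarrow> p \<and> (\<exists>M>0. \<exists>Mbar>0. \<forall>k.
      E k \<le> M * q ^ k \<and> dist (x k) p \<le> Mbar * q powr (real k / 2))"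
    by (rule local_contraction_imp_linear_rate[where \<epsilon> = "\<delta> / 2", OF E0 Elim Edec step _ r q _ contr])
      (use L \<delta> in simp_all)
  then show ?thesis using p by (auto simp: E_def dist_norm)
qed

end
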